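(* Let $r\ge 1$, let $\mu_1<\mu_2<\dots<\mu_r$ and $a_1,\dots,a_r$ be positive integers, and let $I=\langle \mathrm{Inc}(\mathbb{N})\cdot x_{\mu_1}^{a_1}x_{\mu_2}^{a_2}\cdots x_{\mu_r}^{a_r}\rangle\subset K[X]=K[x_j \mid j\in\mathbb{N}]$. Then \[ H_{K[X]/I}(s,t)=\frac{g(s,t)}{(1-t)^{\mu_r-1}\prod_{j=1}^{r}\bigl[1-s\cdot(1+t+\cdots+t^{a_j-1})\bigr]}, \] where $g(s,t)\in\mathbb{Z}[s,t]$ is a polynomial that is not divisible by any of the indicated irreducible factors of the denominator, i.e. neither by $1-t$ nor by any of the polynomials $1-s(1+t+\cdots+t^{a_j-1})$, $1\le j\le r$.
   Context: $K$ is a field, $\mathbb{N}$ is the set of positive integers, and $K[X]=K[x_j\mid j\in\mathbb{N}]$ is the standard graded polynomial ring in infinitely many variables. $\mathrm{Inc}(\mathbb{N})=\{\pi:\mathbb{N}\to\mathbb{N}\mid \pi(i)<\pi(i+1)\text{ for all } i\ge 1\}$ is the monoid of strictly increasing functions; it acts on $K[X]$ by $K$-algebra endomorphisms with $\pi\cdot x_j=x_{\pi(j)}$. For a monomial $m$, $\langle \mathrm{Inc}(\mathbb{N})\cdot m\rangle$ is the ideal of $K[X]$ generated by the orbit $\{\pi\cdot m\mid \pi\in \mathrm{Inc}(\mathbb{N})\}$. For an integer $n\ge 0$ put $K[X_n]=K[x_1,\dots,x_n]$ (so $K[X_0]=K$) and $I_n=I\cap K[X_n]$. The equivariant Hilbert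 series of $K[X]/I$ is the formal power series $H_{K[X]/I}(s,t)=\sum_{n\ge 0,\,j\ge 0}\dim_K[K[X_n]/I_n]_j\, s^nt^j$, where $[\,\cdot\,]_j$ denotes the degree $j$ component. *)

theory Defs
  imports
    "HOL-Library.FuncSet"
    "HOL-Library.Poly_Mapping"
    "HOL-Computational_Algebra.Computational_Algebra"
    "HOL-Algebra.QuotRing"
    "HOL-Algebra.Embedded_Algebras"
begin

text \<open>
  A monomial is a finitely supported exponent function, a polynomial a finitely supported
  function from monomials to coefficients; both have the ring or monoid operations of
  \<^theory>\<open>HOL-Library.Poly_Mapping\<close>.
  The type admits a variable with index 0; the polynomial rings below are carriers inside
  it that exclude this variable, so that the variables are indexed by the positive integers.
\<close>

type_synonym monomial = "nat \<Rightarrow>\<^sub>0 nat"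

type_synonym 'k polynomial = "monomial \<Rightarrow>\<^sub>0 'k"

definition const :: "'k::field \<Rightarrow> 'k polynomial" where
  "const c = Poly_Mapping.single 0 c"

definition X :: "nat \<Rightarrow> 'k::field polynomial" where
  "X i = Poly_Mapping.single (Poly_Mapping.single i 1) 1"

definition mono_degree :: "monomial \<Rightarrow> nat" where
  "mono_degree m = (\<Sum>i\<in>Poly_Mapping.keys m. Poly_Mapping.lookup m i)"

definition polys_in :: "nat set \<Rightarrow> 'k::field polynomial set" where
  "polys_in V = {p. \<forall>m\<in>Poly_Mapping.keys p. Poly_Mapping.keys m \<subseteq> V}"

definition poly_ring :: "nat set \<Rightarrow> 'k::field polynomial ring" where
  "poly_ring V = \<lparr>carrier = polys_in V, mult = (*), one = 1, zero = 0, add = (+)\<rparr>"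

abbreviation KX :: "'k::field polynomial ring" where
  "KX \<equiv> poly_ring {1..}"

abbreviation KXn :: "nat \<Rightarrow> 'k::field polynomial ring" where
  "KXn n \<equiv> poly_ring {1..n}"

text \<open>The value at 0 of an element of \<open>Inc\<close> is unconstrained and irrelevant.\<close>

definition Inc :: "(nat \<Rightarrow> nat) set" where
  "Inc = {\<pi> \<in> {1..} \<rightarrow> {1..}. \<forall>i\<ge>1. \<pi> i < \<pi> (i + 1)}"

definition inc_act :: "(nat \<Rightarrow> nat) \<Rightarrow> 'k::field polynomial \<Rightarrow> 'k polynomial" where
  "inc_act \<pi> p = (\<Sum>m\<in>Poly_Mapping.keys p. const (Poly_Mapping.lookup p m) * (\<Prod>i\<in>Poly_Mapping.keys m. X (\<pi> i) ^ Poly_Mapping.lookup m i))"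

definition Inc_ideal :: "'k::field polynomial \<Rightarrow> 'k polynomial set" where
  "Inc_ideal p = Idl\<^bsub>KX\<^esub> {inc_act \<pi> p | \<pi>. \<pi> \<in> Inc}"

definition trunc :: "'k::field polynomial set \<Rightarrow> nat \<Rightarrow> 'k polynomial set" where
  "trunc I n = I \<inter> carrier (KXn n)"

definition quot_ring :: "'k::field polynomial set \<Rightarrow> nat \<Rightarrow> 'k polynomial set ring" where
  "quot_ring I n = KXn n Quot trunc I n"

text \<open>The image of the coefficient field \<open>K\<close> in the quotient.\<close>

definition quot_scalars :: "'k::field polynomial set \<Rightarrow> nat \<Rightarrow> 'k polynomial set set" where
  "quot_scalars I n = (\<lambda>c. trunc I n +>\<^bsub>KXn n\<^esub> const c) ` UNIV"

text \<open>The degree \<open>j\<close> component of the quotient by a homogeneous ideal: the classes of the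
  homogeneous polynomials of degree \<open>j\<close>, zero included.\<close>

definition quot_component :: "'k::field polynomial set \<Rightarrow> nat \<Rightarrow> nat \<Rightarrow> 'k polynomial set set" where
  "quot_component I n j =
     (\<lambda>p. trunc I n +>\<^bsub>KXn n\<^esub> p) ` {p \<in> carrier (KXn n). \<forall>m\<in>Poly_Mapping.keys p. mono_degree m = j}"

definition hilbert_fun :: "'k::field polynomial set \<Rightarrow> nat \<Rightarrow> nat \<Rightarrow> nat" where
  "hilbert_fun I n j = ring.dim (quot_ring I n) (quot_scalars I n) (quot_component I n j)"

text \<open>\<open>\<int>[[s,t]]\<close> and \<open>\<int>[s,t]\<close> are the iterated types \<^typ>\<open>int fps fps\<close> and \<^typ>\<open>int poly poly\<close>:
  the outer variable is \<open>s\<close>, the inner one \<open>t\<close>.\<close>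

definition equivariant_hilbert_series :: "'k::field polynomial set \<Rightarrow> int fps fps" where
  "equivariant_hilbert_series I = Abs_fps (\<lambda>n. Abs_fps (\<lambda>j. int (hilbert_fun I n j)))"

definition s_var :: "int poly poly" where
  "s_var = [:0, 1:]"

definition t_var :: "int poly poly" where
  "t_var = [:[:0, 1:]:]"

definition fps_of_poly2 :: "int poly poly \<Rightarrow> int fps fps" where
  "fps_of_poly2 p = fps_of_poly (map_poly fps_of_poly p)"

definition s_factor :: "nat \<Rightarrow> int poly poly" where
  "s_factor a = 1 - s_var * (\<Sum>i<a. t_var ^ i)"

lemma inc_act_X: "inc_act \<pi> (X i) = (X (\<pi> i) :: 'k::field polynomial)"
  by (simp add: inc_act_def X_def const_def mult_single)

lemma polys_in_add: "p \<in> polys_in V \<Longrightarrow> q \<in> polys_in V \<Longrightarrow> p + q \<in> polys_in V"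
  using Poly_Mapping.keys_add[of p q] by (auto simp: polys_in_def)

lemma polys_in_mult:
  assumes "p \<in> polys_in V" "q \<in> polys_in V" shows "p * q \<in> polys_in V"
proof -
  have "Poly_Mapping.keys m \<subseteq> V" if mem: "m \<in> Poly_Mapping.keys (p * q)" for m
  proof -
    obtain a b where "m = a + b" "a \<in> Poly_Mapping.keys p" "b \<in> Poly_Mapping.keys q"
      using mem keys_mult[of p q] by blast
    then show ?thesis
      using assms Poly_Mapping.keys_add[of a b] unfolding polys_in_def by blast
  qed
  then show ?thesis by (simp add: polys_in_def)
qed

lemma poly_ring_cring: "cring (poly_ring V :: 'k::field polynomial ring)"
proof (rule cringI)
  have neg: "- p \<in> polys_in V" if "p \<in> polys_in V" for p :: "'k polynomial"
    using that by (simp add: polys_in_def)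
  show "abelian_group (poly_ring V :: 'k polynomial ring)"
  proof (rule abelian_groupI)
    fix x assume "x \<in> carrier (poly_ring V :: 'k polynomial ring)"
    then show "\<exists>y\<in>carrier (poly_ring V). y \<oplus>\<^bsub>poly_ring V\<^esub> x = \<zero>\<^bsub>poly_ring V\<^esub>"
      using neg[of x] by (intro bexI[of _ "- x"]) (auto simp: poly_ring_def)
  qed (auto simp: poly_ring_def polys_in_add add.assoc add.commute, simp add: polys_in_def)
  show "comm_monoid (poly_ring V :: 'k polynomial ring)"
    by (rule comm_monoidI)
      (auto simp: poly_ring_def polys_in_mult mult.assoc mult.commute, simp add: polys_in_def)
qed (simp add: poly_ring_def distrib_right)

end

theory Submission
  imports Defs "HOL-Library.Sublist"
begin

text \<open>
  Write a monomial of \<open>K[X\<^sub>n]\<close> as the word of its \<open>n\<close> exponents, and let \<open>v\<close> be the word of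
  length \<open>\<mu>\<^sub>r\<close> of the given monomial, including its zero exponents. The gaps that an element of
  \<open>Inc\<close> must respect are exactly accounted for by the zeros, so a monomial lies in \<open>I\<close> iff
  \<open>v\<close> embeds into its word in Higman's sense. Reading words greedily from the left, the
  generating series \<open>G\<^sub>v\<close> of the words into which \<open>v\<close> embeds satisfies
  \<open>(1 - t) (1 - s (1 + \<dots> + t\<^bsup>a-1\<^esup>)) G\<^bsub>a v\<^esub> = s t\<^sup>a G\<^sub>v\<close>, where a letter 0 contributes no factor
  in \<open>s\<close>. With \<open>P\<close> the product of the \<open>s\<close>-factors and \<open>e\<close> the sum of the \<open>a\<^sub>j\<close> this gives
  \<open>(1 - t - s) g = (1 - t)\<^bsup>\<mu>\<^esup> P - s\<^bsup>\<mu>\<^esup> t\<^sup>e\<close>, \<open>\<mu> = \<mu>\<^sub>r\<close>. The right-hand side vanishes at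
  \<open>s = 1 - t\<close>, so \<open>g\<close> is a polynomial; and a factor of the denominator dividing \<open>g\<close> would
  divide \<open>s\<^bsup>\<mu>\<^esup> t\<^sup>e\<close>.
\<close>

section \<open>Generating series of words\<close>

definition word_series :: "nat list set \<Rightarrow> int fps fps" where
  "word_series L =
     Abs_fps (\<lambda>n. Abs_fps (\<lambda>j. int (card {w \<in> L. length w = n \<and> sum_list w = j})))"

definition containing :: "nat list \<Rightarrow> nat list set" where
  "containing v = {w. list_emb (\<le>) v w}"

lemma finite_words: "finite {w \<in> L. length w = n \<and> sum_list w = (j::nat)}"
proof -
  have "{w \<in> L. length w = n \<and> sum_list w = j} \<subseteq> {w. set w \<subseteq> {..j} \<and> length w = n}"
    by (auto simp: member_le_sum_list)
  then show ?thesis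
    by (rule finite_subset) (rule finite_lists_length_eq, rule finite_atMost)
qed

lemma word_series_nth:
  "word_series L $ n $ j = int (card {w \<in> L. length w = n \<and> sum_list w = j})"
  by (simp add: word_series_def)

lemma word_series_diff: "word_series (- L) = word_series UNIV - word_series L"
proof (intro fps_ext)
  fix n j :: nat
  let ?A = "\<lambda>L. {w \<in> L. length w = n \<and> sum_list w = j}"
  have "?A UNIV = ?A (- L) \<union> ?A L" by auto
  moreover have "card (?A (- L) \<union> ?A L) = card (?A (- L)) + card (?A L)"
    by (rule card_Un_disjoint[OF finite_words finite_words]) auto
  ultimately have "card (?A UNIV) = card (?A (- L)) + card (?A L)"
    by (simp only:)
  then show "word_series (- L) $ n $ j = (word_series UNIV - word_series L) $ n $ j"
    by (simp add: word_series_nth)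
qed

definition letter_series :: "nat set \<Rightarrow> int fps fps" where
  "letter_series A = fps_const (Abs_fps (\<lambda>x. if x \<in> A then 1 else 0))"

lemma word_series_first_letter:
  assumes 1: "\<And>x w. x \<in> A \<Longrightarrow> x # w \<in> L \<longleftrightarrow> w \<in> L1"
    and 2: "\<And>x w. x \<notin> A \<Longrightarrow> x # w \<in> L \<longleftrightarrow> w \<in> L2"
  shows "word_series L = (if [] \<in> L then 1 else 0)
    + fps_X * (letter_series A * word_series L1 + letter_series (- A) * word_series L2)"
    (is "_ = ?R")
proof (intro fps_ext)
  fix n j :: nat
  show "word_series L $ n $ j = ?R $ n $ j"
  proof (cases n)
    case 0
    have "{w \<in> L. length w = 0 \<and> sum_list w = j} = (if [] \<in> L \<and> j = 0 then {[]} else {})"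
      by auto
    then show ?thesis by (simp add: 0 word_series_nth)
  next
    case (Suc k)
    let ?C = "\<lambda>x. {w. x # w \<in> L \<and> length w = k \<and> sum_list w = j - x}"
    have "{w \<in> L. length w = n \<and> sum_list w = j} = (\<Union>x\<in>{0..j}. (#) x ` ?C x)"
      by (auto simp: Suc length_Suc_conv image_iff)
    moreover have fin: "finite (?C x)" for x
      using finite_words[of "{w. x # w \<in> L}" k "j - x"] by simp
    ultimately have "card {w \<in> L. length w = n \<and> sum_list w = j} = (\<Sum>x=0..j. card ((#) x ` ?C x))"
      by (simp only:) (rule card_UN_disjoint, auto)
    also have "\<dots> = (\<Sum>x=0..j. card (?C x))"
      by (simp add: card_image)
    finally have "word_series L $ n $ j = (\<Sum>x=0..j. int (card (?C x)))"
      by (simp add: word_series_nth)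
    also have "\<dots> = (\<Sum>x=0..j. (if x \<in> A then word_series L1 $ k $ (j - x) else 0)
        + (if x \<in> - A then word_series L2 $ k $ (j - x) else 0))"
      by (rule sum.cong) (auto simp: 1 2 word_series_nth)
    also have "\<dots> = ((Abs_fps (\<lambda>x. if x \<in> A then 1 else 0) * word_series L1 $ k)
        + (Abs_fps (\<lambda>x. if x \<in> - A then 1 else 0) * word_series L2 $ k)) $ j"
      by (simp add: fps_mult_nth sum.distrib if_distrib[of "\<lambda>c. c * _"] cong: if_cong)
    also have "\<dots> = ?R $ n $ j"
      by (simp add: Suc letter_series_def)
    finally show ?thesis .
  qed
qed

lemma letter_series_atLeast:
  "(1 - fps_const fps_X) * letter_series {a..} = fps_const fps_X ^ a"
proof -
  have "(1 - fps_X) * Abs_fps (\<lambda>x. if x \<in> {a..} then 1 else 0) = (fps_X ^ a :: int fps)"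
    by (rule fps_ext) (auto simp: left_diff_distrib fps_X_power_nth)
  from arg_cong[OF this, of fps_const] show ?thesis
    by (simp only: letter_series_def fps_const_1_eq_1 fps_const_power flip: fps_const_mult fps_const_sub)
qed

lemma letter_series_lessThan: "letter_series (- {a..}) = (\<Sum>i<a. fps_const fps_X ^ i)"
proof -
  have "Abs_fps (\<lambda>x. if x \<in> - {a..} then 1 else 0) = (\<Sum>i<a. fps_X ^ i :: int fps)"
    by (rule fps_ext) (simp add: fps_sum_nth fps_X_power_nth not_le)
  moreover have "fps_const (\<Sum>i<a. fps_X ^ i :: int fps) = (\<Sum>i<a. fps_const fps_X ^ i)"
    by (induction a) (simp_all only: lessThan_0 sum.empty fps_const_0_eq_0 sum.lessThan_Suc
        fps_const_power flip: fps_const_add)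
  ultimately show ?thesis by (simp only: letter_series_def)
qed

lemma Cons_containing_Cons:
  "y # w \<in> containing (x # v) \<longleftrightarrow> w \<in> containing (if x \<le> y then v else x # v)"
  by (simp add: containing_def)

lemma solve_linear_recurrence:
  fixes W :: "'a::comm_ring_1"
  assumes "W = c + x * (u * V + l * W)"
  shows "(1 - x * l) * W = c + x * u * V"
proof -
  have "(1 - x * l) * W = W - x * (l * W)"
    by (simp add: algebra_simps)
  also have "\<dots> = c + x * u * V"
    by (subst (1) assms) (simp add: algebra_simps)
  finally show ?thesis .
qed

lemma word_series_UNIV:
  "(1 - fps_const fps_X - fps_X) * word_series UNIV = 1 - fps_const fps_X"
proof -
  have "(1 - fps_X * letter_series {0..}) * word_series UNIV = 1 + fps_X * letter_series (- {0..}) * word_series {}"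
  proof (rule solve_linear_recurrence)
    show "word_series UNIV = 1 + fps_X * (letter_series (- {0..}) * word_series {} + letter_series {0..} * word_series UNIV)"
      by (rule trans[OF word_series_first_letter[of "{0..}" UNIV UNIV "{}"]]) (simp_all add: add.commute)
  qed
  also have "letter_series (- {0..}) = 0"
    by (simp only: letter_series_lessThan lessThan_0 sum.empty)
  finally have "(1 - fps_X * letter_series {0..}) * word_series UNIV = 1"
    by simp
  moreover have "((1 - fps_const fps_X) - fps_X * ((1 - fps_const fps_X) * letter_series {0..})) * word_series UNIV
      = (1 - fps_const fps_X) * ((1 - fps_X * letter_series {0..}) * word_series UNIV)"
    by (simp only: left_diff_distrib right_diff_distrib mult_1 ac_simps)
  ultimately have "((1 - fps_const fps_X) - fps_X * ((1 - fps_const fps_X) * letter_series {0..})) * word_series UNIV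
      = 1 - fps_const fps_X"
    by (simp only: mult_1_right)
  then show ?thesis
    by (simp only: letter_series_atLeast power_0 mult_1_right)
qed

abbreviation s_factor_series :: "nat \<Rightarrow> int fps fps" where
  "s_factor_series a \<equiv> 1 - fps_X * (\<Sum>i<a. fps_const fps_X ^ i)"

lemma word_series_containing_Cons:
  "(1 - fps_const fps_X) * s_factor_series a * word_series (containing (a # v)) =
    fps_X * fps_const fps_X ^ a * word_series (containing v)"
proof -
  let ?W = "word_series (containing (a # v))"
  have "(1 - fps_X * letter_series (- {a..})) * ?W = 0 + fps_X * letter_series {a..} * word_series (containing v)"
  proof (rule solve_linear_recurrence)
    have "[] \<notin> containing (a # v)" by (simp add: containing_def)
    with word_series_first_letter[of "{a..}" "containing (a # v)" "containing v" "containing (a # v)"]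
    show "?W = 0 + fps_X * (letter_series {a..} * word_series (containing v) + letter_series (- {a..}) * ?W)"
      by (simp only: Cons_containing_Cons atLeast_iff if_True if_False)
  qed
  then have "s_factor_series a * ?W = fps_X * letter_series {a..} * word_series (containing v)"
    by (simp only: letter_series_lessThan add_0_left)
  then have "(1 - fps_const fps_X) * s_factor_series a * ?W =
     fps_X * ((1 - fps_const fps_X) * letter_series {a..}) * word_series (containing v)"
    by (simp only: mult.assoc mult.left_commute)
  then show ?thesis by (simp only: letter_series_atLeast)
qed

lemma word_series_containing:
  "(1 - fps_const fps_X) ^ length v * prod_list (map s_factor_series v)
      * ((1 - fps_const fps_X - fps_X) * word_series (containing v)) =
    (1 - fps_const fps_X) * (fps_X ^ length v * fps_const fps_X ^ sum_list v)"
proof (induction v)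
  case Nil
  have "containing [] = UNIV" by (simp add: containing_def)
  then show ?case by (simp add: word_series_UNIV)
next
  case (Cons a v)
  let ?t = "fps_const fps_X :: int fps fps"
  let ?P = "(1 - ?t) ^ length v * prod_list (map s_factor_series v)"
  have "(1 - ?t) ^ length (a # v) * prod_list (map s_factor_series (a # v))
      * ((1 - ?t - fps_X) * word_series (containing (a # v)))
    = ?P * (1 - ?t - fps_X) * ((1 - ?t) * s_factor_series a * word_series (containing (a # v)))"
    by (simp only: list.size list.map prod_list.Cons power_Suc add_0_right One_nat_def add_Suc_right mult.commute mult.left_commute mult.assoc)
  also have "\<dots> = fps_X * ?t ^ a * (?P * ((1 - ?t - fps_X) * word_series (containing v)))"
    unfolding word_series_containing_Cons by (simp only: ac_simps)
  also have "\<dots> = (1 - ?t) * (fps_X ^ length (a # v) * ?t ^ sum_list (a # v))"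
    by (simp only: Cons.IH) (simp add: power_add ac_simps)
  finally show ?case .
qed

section \<open>Rational form of the generating series\<close>

lemma fps_of_poly2_nth: "fps_of_poly2 p $ n = fps_of_poly (Polynomial.coeff p n)"
  by (simp add: fps_of_poly2_def coeff_map_poly)

lemma fps_of_poly2_add: "fps_of_poly2 (p + q) = fps_of_poly2 p + fps_of_poly2 q"
  by (rule fps_ext) (simp add: fps_of_poly2_nth fps_of_poly_add)

lemma fps_of_poly2_diff: "fps_of_poly2 (p - q) = fps_of_poly2 p - fps_of_poly2 q"
  by (rule fps_ext) (simp add: fps_of_poly2_nth fps_of_poly_diff)

lemma fps_of_poly2_mult: "fps_of_poly2 (p * q) = fps_of_poly2 p * fps_of_poly2 q"
  by (rule fps_ext)
    (simp add: fps_of_poly2_nth fps_mult_nth coeff_mult fps_of_poly_sum fps_of_poly_mult atMost_atLeast0)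

lemma fps_of_poly2_0: "fps_of_poly2 0 = 0"
  by (rule fps_ext) (simp add: fps_of_poly2_nth)

lemma fps_of_poly2_1: "fps_of_poly2 1 = 1"
  by (rule fps_ext) (simp add: fps_of_poly2_nth coeff_1)

lemma fps_of_poly2_power: "fps_of_poly2 (p ^ n) = fps_of_poly2 p ^ n"
  by (induction n) (simp_all add: fps_of_poly2_1 fps_of_poly2_mult)

lemma fps_of_poly2_sum: "fps_of_poly2 (sum f A) = (\<Sum>x\<in>A. fps_of_poly2 (f x))"
  by (induction A rule: infinite_finite_induct) (simp_all add: fps_of_poly2_0 fps_of_poly2_add)

lemma fps_of_poly2_prod_list: "fps_of_poly2 (prod_list (map f xs)) = prod_list (map (\<lambda>x. fps_of_poly2 (f x)) xs)"
  by (induction xs) (simp_all add: fps_of_poly2_1 fps_of_poly2_mult)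

lemma fps_of_poly2_s_var: "fps_of_poly2 s_var = fps_X"
  by (rule fps_ext) (auto simp: fps_of_poly2_nth s_var_def coeff_pCons split: nat.split)

lemma fps_of_poly2_t_var: "fps_of_poly2 t_var = fps_const fps_X"
  by (rule fps_ext) (auto simp: fps_of_poly2_nth t_var_def coeff_pCons fps_of_poly_fps_X split: nat.split)

lemmas fps_of_poly2_simps = fps_of_poly2_add fps_of_poly2_diff fps_of_poly2_mult fps_of_poly2_0
  fps_of_poly2_1 fps_of_poly2_power fps_of_poly2_sum fps_of_poly2_prod_list
  fps_of_poly2_s_var fps_of_poly2_t_var

lemma fps_of_poly2_s_factor: "fps_of_poly2 (s_factor a) = s_factor_series a"
  by (simp add: s_factor_def fps_of_poly2_simps)

lemma t_var_power: "t_var ^ i = [:[:0, 1:] ^ i:]"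
  by (induction i) (simp_all add: t_var_def one_pCons)

lemma t_var_power_sum: "(\<Sum>i<a. t_var ^ i) = [:\<Sum>i<a. [:0, 1:] ^ i:]"
  by (induction a) (simp_all add: t_var_power)

lemma s_factor_eq: "s_factor a = [:1, - (\<Sum>i<a. [:0, 1:] ^ i):]"
  by (simp add: s_factor_def s_var_def t_var_power_sum one_pCons)

lemma one_minus_t_var_eq: "1 - t_var = [:[:1, - 1:]:]"
  by (simp add: t_var_def one_pCons)

lemma irreducible_one_linear:
  fixes b :: "'a::idom_divide"
  assumes "b \<noteq> 0" shows "Factorial_Ring.irreducible [:1, b:]"
proof (rule irreducibleI)
  show "[:1, b:] \<noteq> 0" by simp
  show "\<not> is_unit [:1, b:]" using assms by (auto simp: is_unit_poly_iff)
next
  fix p q assume pq: "[:1, b:] = p * q"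
  have unit: "is_unit p" if pq: "[:1, b:] = p * q" and deg: "Polynomial.degree p = 0" for p q
  proof -
    from deg obtain c where c: "p = [:c:]" by (rule degree_eq_zeroE)
    have "Polynomial.coeff [:1, b:] 0 = Polynomial.coeff (p * q) 0" by (simp only: pq)
    then have "1 = c * Polynomial.coeff q 0" by (simp add: c)
    then show ?thesis by (metis c dvd_triv_left is_unit_const_poly_iff)
  qed
  have "p \<noteq> 0" "q \<noteq> 0" using pq by auto
  then have "Polynomial.degree p + Polynomial.degree q = 1"
    using pq assms degree_mult_eq[of p q] by (metis degree_pCons_eq degree_0 degree_pCons_0 One_nat_def pCons_eq_0_iff)
  then have "Polynomial.degree p = 0 \<or> Polynomial.degree q = 0" by arith
  then show "is_unit p \<or> is_unit q" using unit[OF pq] unit[of q p] pq by (auto simp: mult.commute)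
qed

lemma geometric_sum_poly_neq_0: "a > 0 \<Longrightarrow> (\<Sum>i<a. [:0, 1:] ^ i :: int poly) \<noteq> 0"
proof
  assume "a > 0" and 0: "(\<Sum>i<a. [:0, 1:] ^ i :: int poly) = 0"
  have "poly (\<Sum>i<a. [:0, 1:] ^ i :: int poly) 1 = int a"
    by (simp add: poly_sum poly_power)
  then show False using 0 \<open>a > 0\<close> by simp
qed

lemma irreducible_s_factor: "a > 0 \<Longrightarrow> Factorial_Ring.irreducible (s_factor a)"
  unfolding s_factor_eq by (rule irreducible_one_linear) (simp add: geometric_sum_poly_neq_0)

lemma irreducible_one_minus_t_var: "Factorial_Ring.irreducible (1 - t_var)"
  unfolding one_minus_t_var_eq by (simp add: irreducible_const_poly_iff irreducible_one_linear)

lemma s_factor_0 [simp]: "s_factor 0 = 1"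
  by (simp add: s_factor_def)

lemma one_minus_t_var_not_dvd: "\<not> (1 - t_var) dvd s_var ^ m * t_var ^ n"
proof
  assume "(1 - t_var) dvd s_var ^ m * t_var ^ n"
  then obtain h where "s_var ^ m * t_var ^ n = (1 - t_var) * h" ..
  then have "poly (poly (s_var ^ m * t_var ^ n) 1) 1 = poly (poly ((1 - t_var) * h) 1) 1" by simp
  then show False by (simp add: s_var_def t_var_def poly_power)
qed

text \<open>Modulo \<open>s_factor a\<close> the variable \<open>s\<close> is invertible, and a power of \<open>t\<close> has degree 0 in \<open>s\<close>.\<close>

lemma s_factor_not_dvd:
  assumes "a > 0" shows "\<not> s_factor a dvd s_var ^ m * t_var ^ n"
proof
  assume d: "s_factor a dvd s_var ^ m * t_var ^ n"
  have "coprime (s_factor a) s_var"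
  proof (rule coprimeI)
    fix c assume "c dvd s_factor a" "c dvd s_var"
    then have "c dvd s_factor a + s_var * (\<Sum>i<a. t_var ^ i)" by (intro dvd_add dvd_mult2)
    then show "is_unit c" by (simp add: s_factor_def)
  qed
  then have "coprime (s_factor a) (s_var ^ m)" by simp
  then have "s_factor a dvd t_var ^ n" using d by (simp add: coprime_dvd_mult_right_iff)
  then have "Polynomial.degree (s_factor a) \<le> Polynomial.degree (t_var ^ n)"
    by (rule dvd_imp_degree_le) (simp add: t_var_def)
  then show False using geometric_sum_poly_neq_0[OF assms] by (simp add: s_factor_eq t_var_power)
qed

lemma numerator_exists:
  assumes "v \<noteq> []"
  obtains g where
    "(1 - t_var) ^ length v * prod_list (map s_factor v) - s_var ^ length v * t_var ^ sum_list v
       = (1 - t_var - s_var) * g"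
proof -
  let ?c = "[:1, - 1:] :: int poly"
  have s: "poly (s_factor a) ?c = [:0, 1:] ^ a" for a
  proof -
    have "(1 - [:0, 1:]) * (\<Sum>i<a. [:0, 1:] ^ i :: int poly) = 1 - [:0, 1:] ^ a" for a :: nat
      using one_diff_power_eq[of "[:0, 1:] :: int poly" a] by (simp only:)
    then show ?thesis by (simp add: s_factor_eq one_pCons)
  qed
  have "poly (prod_list (map s_factor v)) ?c = [:0, 1:] ^ sum_list v"
    by (induction v) (simp_all add: s power_add)
  then have "poly ((1 - t_var) ^ length v * prod_list (map s_factor v) - s_var ^ length v * t_var ^ sum_list v) ?c = 0"
    by (simp add: one_minus_t_var_eq s_var_def t_var_power poly_power)
  then have "[:- ?c, 1:] dvd (1 - t_var) ^ length v * prod_list (map s_factor v) - s_var ^ length v * t_var ^ sum_list v"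
    by (simp only: poly_eq_0_iff_dvd)
  moreover have "1 - t_var - s_var = - [:- ?c, 1:]"
    by (simp add: one_minus_t_var_eq s_var_def)
  ultimately have "1 - t_var - s_var dvd (1 - t_var) ^ length v * prod_list (map s_factor v) - s_var ^ length v * t_var ^ sum_list v"
    by (metis minus_dvd_iff)
  then show ?thesis using that by (auto elim: dvdE)
qed

lemma word_series_not_containing:
  assumes "v \<noteq> []"
  obtains g where
    "word_series (- containing v) * fps_of_poly2 ((1 - t_var) ^ (length v - 1) * prod_list (map s_factor v))
       = fps_of_poly2 g"
    "\<not> (1 - t_var) dvd g" "\<And>a. a \<in> set v \<Longrightarrow> a > 0 \<Longrightarrow> \<not> s_factor a dvd g"
proof -
  obtain g where g: "(1 - t_var) ^ length v * prod_list (map s_factor v) - s_var ^ length v * t_var ^ sum_list v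
       = (1 - t_var - s_var) * g" using numerator_exists[OF assms] .
  let ?t = "fps_const fps_X :: int fps fps"
  let ?S = "prod_list (map s_factor_series v)"
  have distr: "x * d * ((U - C) * (e * S)) = x * e * S * (d * U) - x * e * S * (d * C)"
    for x d U C e S :: "int fps fps"
    by (simp add: algebra_simps)
  have pw: "(1 - ?t) ^ length v = (1 - ?t) * (1 - ?t) ^ (length v - 1)"
    using assms by (cases v) auto
  have "(1 - ?t) * (1 - ?t - fps_X) * (word_series (- containing v) * ((1 - ?t) ^ (length v - 1) * ?S))
     = (1 - ?t) ^ length v * ?S * ((1 - ?t - fps_X) * word_series UNIV)
     - (1 - ?t) ^ length v * ?S * ((1 - ?t - fps_X) * word_series (containing v))"
    unfolding word_series_diff pw by (rule distr)
  also have "\<dots> = (1 - ?t) * ((1 - ?t) ^ length v * ?S - fps_X ^ length v * ?t ^ sum_list v)"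
    unfolding word_series_containing word_series_UNIV by (simp only: right_diff_distrib mult.commute)
  also have "(1 - ?t) ^ length v * ?S - fps_X ^ length v * ?t ^ sum_list v = (1 - ?t - fps_X) * fps_of_poly2 g"
    using arg_cong[OF g, of fps_of_poly2] by (simp add: fps_of_poly2_simps fps_of_poly2_s_factor)
  finally have "(1 - ?t) * (1 - ?t - fps_X) * (word_series (- containing v) * ((1 - ?t) ^ (length v - 1) * ?S))
     = (1 - ?t) * (1 - ?t - fps_X) * fps_of_poly2 g" by (simp only: mult.assoc)
  moreover have "(1 - ?t) $ 0 $ 0 \<noteq> 0" "(1 - ?t - fps_X) $ 0 $ 0 \<noteq> 0" by simp_all
  then have "(1 - ?t) * (1 - ?t - fps_X) \<noteq> 0" by (metis fps_zero_nth no_zero_divisors)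
  ultimately have "word_series (- containing v) * ((1 - ?t) ^ (length v - 1) * ?S) = fps_of_poly2 g"
    by (simp only: mult_cancel_left simp_thms)
  then have 1: "word_series (- containing v) * fps_of_poly2 ((1 - t_var) ^ (length v - 1) * prod_list (map s_factor v))
       = fps_of_poly2 g"
    by (simp add: fps_of_poly2_simps fps_of_poly2_s_factor)
  have dvd: "d dvd s_var ^ length v * t_var ^ sum_list v"
    if "d dvd g" "d dvd (1 - t_var) ^ length v * prod_list (map s_factor v)" for d
  proof -
    have "d dvd (1 - t_var) ^ length v * prod_list (map s_factor v) - (1 - t_var - s_var) * g"
      using that by (intro dvd_diff) auto
    then show ?thesis by (simp flip: g)
  qed
  have 2: "\<not> (1 - t_var) dvd g"
  proof
    assume "(1 - t_var) dvd g"
    then have "(1 - t_var) dvd s_var ^ length v * t_var ^ sum_list v"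
      by (rule dvd) (use assms in \<open>auto intro!: dvd_mult2 dvd_power\<close>)
    then show False using one_minus_t_var_not_dvd by blast
  qed
  have 3: "\<not> s_factor a dvd g" if "a \<in> set v" "a > 0" for a
  proof
    assume "s_factor a dvd g"
    then have "s_factor a dvd s_var ^ length v * t_var ^ sum_list v"
      by (rule dvd) (use that in \<open>auto simp: in_set_conv_decomp intro: dvd_mult\<close>)
    then show False using s_factor_not_dvd[OF that(2)] by blast
  qed
  show ?thesis using that 1 2 3 by blast
qed

section \<open>Monomial ideals and their quotients\<close>

abbreviation monomials_in :: "nat set \<Rightarrow> monomial set" where
  "monomials_in V \<equiv> {m. Poly_Mapping.keys m \<subseteq> V}"

definition supported :: "monomial set \<Rightarrow> 'k::field polynomial set" where
  "supported A = {p. Poly_Mapping.keys p \<subseteq> A}"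

lemma polys_in_eq_supported: "polys_in V = supported (monomials_in V)"
  by (auto simp: polys_in_def supported_def)

lemma carrier_poly_ring: "carrier (poly_ring V) = supported (monomials_in V)"
  by (simp add: poly_ring_def polys_in_eq_supported)

lemma supported_Int: "supported A \<inter> supported B = supported (A \<inter> B)"
  by (auto simp: supported_def)

lemma supported_mono: "A \<subseteq> B \<Longrightarrow> supported A \<subseteq> supported B"
  by (auto simp: supported_def)

lemma supported_0: "0 \<in> supported A"
  by (simp add: supported_def)

lemma supported_add: "p \<in> supported A \<Longrightarrow> q \<in> supported A \<Longrightarrow> p + q \<in> supported A"
  using Poly_Mapping.keys_add[of p q] by (auto simp: supported_def)

lemma supported_uminus: "p \<in> supported A \<Longrightarrow> - p \<in> supported A"
  by (simp add: supported_def)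

lemma supported_diff: "p \<in> supported A \<Longrightarrow> q \<in> supported A \<Longrightarrow> p - q \<in> supported A"
  using supported_add[of p A "- q"] supported_uminus[of q A] by simp

lemma supported_mult:
  assumes "p \<in> supported A" "q \<in> supported B" "\<And>x y. x \<in> A \<Longrightarrow> y \<in> B \<Longrightarrow> x + y \<in> C"
  shows "p * q \<in> supported C"
  using keys_mult[of p q] assms by (fastforce simp: supported_def)

lemma supported_single: "m \<in> A \<Longrightarrow> Poly_Mapping.single m c \<in> supported A"
  by (simp add: supported_def)

lemma polynomial_eq_sum_singles:
  "(\<Sum>m\<in>Poly_Mapping.keys p. Poly_Mapping.single m (Poly_Mapping.lookup p m)) = p"
proof (rule poly_mapping_eqI)
  fix k
  have "Poly_Mapping.lookup (\<Sum>m\<in>Poly_Mapping.keys p. Poly_Mapping.single m (Poly_Mapping.lookup p m)) k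
    = (\<Sum>m\<in>Poly_Mapping.keys p. if m = k then Poly_Mapping.lookup p m else 0)"
    by (simp add: lookup_sum lookup_single when_def)
  also have "\<dots> = Poly_Mapping.lookup p k"
    by (simp add: sum.delta' in_keys_iff)
  finally show "Poly_Mapping.lookup (\<Sum>m\<in>Poly_Mapping.keys p. Poly_Mapping.single m (Poly_Mapping.lookup p m)) k
    = Poly_Mapping.lookup p k" .
qed

lemma polynomial_split:
  obtains p1 p2 where "p = p1 + p2"
    "Poly_Mapping.keys p1 = Poly_Mapping.keys p \<inter> A" "Poly_Mapping.keys p2 = Poly_Mapping.keys p - A"
proof -
  define P where "P B = Abs_poly_mapping (\<lambda>m. if m \<in> B then Poly_Mapping.lookup p m else 0)" for B
  have P: "Poly_Mapping.lookup (P B) = (\<lambda>m. if m \<in> B then Poly_Mapping.lookup p m else 0)" for B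
    unfolding P_def
  proof (rule lookup_Abs_poly_mapping)
    have "{m. (if m \<in> B then Poly_Mapping.lookup p m else 0) \<noteq> 0} \<subseteq> Poly_Mapping.keys p"
      by (auto simp: in_keys_iff split: if_splits)
    then show "finite {m. (if m \<in> B then Poly_Mapping.lookup p m else 0) \<noteq> 0}"
      by (rule finite_subset) simp
  qed
  show thesis
  proof (rule that)
    show "p = P A + P (- A)"
      by (rule poly_mapping_eqI) (simp add: lookup_add P)
    show "Poly_Mapping.keys (P A) = Poly_Mapping.keys p \<inter> A"
      "Poly_Mapping.keys (P (- A)) = Poly_Mapping.keys p - A"
      by (auto simp: in_keys_iff P split: if_splits)
  qed
qed

lemma supported_ideal:
  assumes "A \<subseteq> monomials_in V"
    and up: "\<And>m h. m \<in> A \<Longrightarrow> h \<in> monomials_in V \<Longrightarrow> m + h \<in> A"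
  shows "ideal (supported A) (poly_ring V :: 'k::field polynomial ring)"
proof -
  interpret R: cring "poly_ring V :: 'k polynomial ring" by (rule poly_ring_cring)
  have up': "p * q \<in> supported A"
    if "p \<in> supported A" "q \<in> supported (monomials_in V)" for p q :: "'k polynomial"
    by (rule supported_mult[OF that]) (rule up)
  show ?thesis
  proof (rule idealI)
    show "subgroup (supported A) (add_monoid (poly_ring V :: 'k polynomial ring))"
    proof (rule R.add.subgroupI)
      show "supported A \<subseteq> carrier (poly_ring V)"
        unfolding carrier_poly_ring by (rule supported_mono[OF assms(1)])
      show "supported A \<noteq> {}" using supported_0 by blast
    next
      fix p :: "'k polynomial" assume p: "p \<in> supported A"
      have "- p \<in> carrier (poly_ring V)" "p \<in> carrier (poly_ring V)"
        using supported_mono[OF assms(1)] p supported_uminus[OF p] by (auto simp: carrier_poly_ring)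
      then have "\<ominus>\<^bsub>poly_ring V\<^esub> p = - p"
        by (intro R.minus_equality) (auto simp: poly_ring_def)
      then show "\<ominus>\<^bsub>poly_ring V\<^esub> p \<in> supported A"
        using supported_uminus[OF p] by simp
    next
      fix p q :: "'k polynomial" assume "p \<in> supported A" "q \<in> supported A"
      then show "p \<oplus>\<^bsub>poly_ring V\<^esub> q \<in> supported A"
        by (simp add: poly_ring_def supported_add)
    qed
  next
    fix p x :: "'k polynomial" assume "p \<in> supported A" "x \<in> carrier (poly_ring V)"
    then have "p * x \<in> supported A" by (intro up') (auto simp: carrier_poly_ring)
    then show "x \<otimes>\<^bsub>poly_ring V\<^esub> p \<in> supported A" "p \<otimes>\<^bsub>poly_ring V\<^esub> x \<in> supported A"
      by (simp_all add: poly_ring_def mult.commute)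
  qed (rule R.ring_axioms)
qed

definition monomial_multiples :: "monomial set \<Rightarrow> monomial set" where
  "monomial_multiples G = {g + h | g h. g \<in> G}"

lemma genideal_monomials:
  assumes G: "G \<subseteq> monomials_in V"
  shows "Idl\<^bsub>poly_ring V\<^esub> {Poly_Mapping.single g (1::'k::field) | g. g \<in> G} =
    supported (monomial_multiples G \<inter> monomials_in V)" (is "Idl\<^bsub>?R\<^esub> ?S = supported ?A")
proof
  interpret R: cring ?R by (rule poly_ring_cring)
  have sub: "?S \<subseteq> carrier ?R"
    using G by (auto simp: carrier_poly_ring intro!: supported_single)
  have add_in: "x + y \<in> monomials_in V" if "x \<in> monomials_in V" "y \<in> monomials_in V" for x y :: monomial
    using that Poly_Mapping.keys_add[of x y] by auto
  have "ideal (supported ?A) ?R"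
  proof (rule supported_ideal)
    fix m h assume "m \<in> ?A" and h: "h \<in> monomials_in V"
    then obtain g h' where "m = g + h'" "g \<in> G" and m: "m \<in> monomials_in V"
      by (auto simp: monomial_multiples_def)
    then have "m + h = g + (h' + h)" by (simp add: add.assoc)
    then show "m + h \<in> ?A" using \<open>g \<in> G\<close> add_in[OF m h] by (auto simp: monomial_multiples_def)
  qed simp
  then show "Idl\<^bsub>?R\<^esub> ?S \<subseteq> supported ?A"
  proof (rule R.genideal_minimal)
    have "G \<subseteq> monomial_multiples G"
      by (auto simp: monomial_multiples_def) (metis add_0_right)
    with G show "?S \<subseteq> supported ?A" by (auto intro!: supported_single)
  qed
  interpret I: ideal "Idl\<^bsub>?R\<^esub> ?S" ?R by (rule R.genideal_ideal[OF sub])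
  have mon: "Poly_Mapping.single m c \<in> Idl\<^bsub>?R\<^esub> ?S" if "m \<in> ?A" for m c
  proof -
    from that obtain g h where m: "m = g + h" "g \<in> G" "m \<in> monomials_in V"
      by (auto simp: monomial_multiples_def)
    have "Poly_Mapping.keys h \<subseteq> Poly_Mapping.keys m"
      by (auto simp: m(1) in_keys_iff lookup_add)
    then have "Poly_Mapping.single h c \<in> carrier ?R"
      using m(3) by (auto simp: carrier_poly_ring intro!: supported_single)
    moreover have "Poly_Mapping.single g 1 \<in> Idl\<^bsub>?R\<^esub> ?S"
      using R.genideal_self[OF sub] m(2) by auto
    ultimately have "Poly_Mapping.single h c \<otimes>\<^bsub>?R\<^esub> Poly_Mapping.single g 1 \<in> Idl\<^bsub>?R\<^esub> ?S"
      by (intro I.I_l_closed)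
    then show ?thesis by (simp add: poly_ring_def mult_single m(1) add.commute)
  qed
  show "supported ?A \<subseteq> Idl\<^bsub>?R\<^esub> ?S"
  proof
    fix p :: "'k polynomial" assume p: "p \<in> supported ?A"
    have "(\<Sum>m\<in>B. Poly_Mapping.single m (Poly_Mapping.lookup p m)) \<in> Idl\<^bsub>?R\<^esub> ?S"
      if "finite B" "B \<subseteq> ?A" for B
      using that
    proof (induction B)
      case empty
      then show ?case using I.zero_closed by (simp add: poly_ring_def)
    next
      case (insert m B)
      then have "Poly_Mapping.single m (Poly_Mapping.lookup p m) \<oplus>\<^bsub>?R\<^esub>
          (\<Sum>m\<in>B. Poly_Mapping.single m (Poly_Mapping.lookup p m)) \<in> Idl\<^bsub>?R\<^esub> ?S"
        by (intro I.a_closed mon) auto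
      with insert.hyps show ?case by (simp add: poly_ring_def)
    qed
    from this[of "Poly_Mapping.keys p"] p show "p \<in> Idl\<^bsub>?R\<^esub> ?S"
      by (simp add: polynomial_eq_sum_singles supported_def)
  qed
qed

lemma const_1: "const 1 = 1"
  and const_add: "const (c + d) = const c + const d"
  and const_uminus: "const (- c) = - const c"
  and const_mult: "const (c * d) = const c * const d"
  by (simp_all add: const_def mult_single single_add single_uminus)

lemma const_mult_single: "const c * Poly_Mapping.single m d = Poly_Mapping.single m (c * d)"
  by (simp add: const_def mult_single)

lemma const_in_supported: "0 \<in> A \<Longrightarrow> const c \<in> supported A"
  unfolding const_def by (rule supported_single)

lemma const_eq_0_iff: "const c = 0 \<longleftrightarrow> c = 0"
  unfolding const_def by (metis lookup_single_eq single_zero lookup_zero)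

lemma subfield_const: "subfield (range const) (poly_ring V :: 'k::field polynomial ring)"
proof -
  interpret R: cring "poly_ring V :: 'k polynomial ring" by (rule poly_ring_cring)
  have carr: "const c \<in> carrier (poly_ring V :: 'k polynomial ring)" for c
    by (auto simp: carrier_poly_ring intro!: const_in_supported)
  show ?thesis
  proof (rule R.subfieldI)
    show "subcring (range const) (poly_ring V :: 'k polynomial ring)"
    proof (rule R.subcringI', rule R.subringI)
      show "range const \<subseteq> carrier (poly_ring V :: 'k polynomial ring)" using carr by auto
      show "\<one>\<^bsub>poly_ring V\<^esub> \<in> range const" by (auto simp: poly_ring_def const_1[symmetric])
    next
      fix h :: "'k polynomial" assume "h \<in> range const"
      then obtain c where h: "h = const c" by auto
      have "\<ominus>\<^bsub>poly_ring V\<^esub> h = const (- c)"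
        by (rule R.minus_equality) (use carr[of c] carr[of "- c"] in \<open>auto simp: h poly_ring_def const_uminus\<close>)
      then show "\<ominus>\<^bsub>poly_ring V\<^esub> h \<in> range const" by simp
    next
      fix h h' :: "'k polynomial" assume "h \<in> range const" "h' \<in> range const"
      then obtain c d where h: "h = const c" "h' = const d" by auto
      show "h \<otimes>\<^bsub>poly_ring V\<^esub> h' \<in> range const" "h \<oplus>\<^bsub>poly_ring V\<^esub> h' \<in> range const"
        by (auto simp: poly_ring_def h const_mult[symmetric] const_add[symmetric])
    qed
    have "const c \<in> Units (poly_ring V\<lparr>carrier := range const\<rparr>)" if "c \<noteq> 0" for c :: 'k
    proof -
      have "const (inverse c) * const c = (1 :: 'k polynomial)"
        using that by (simp add: const_mult[symmetric] const_1)
      then show ?thesis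
        unfolding Units_def by (auto simp: poly_ring_def mult.commute intro!: exI[of _ "inverse c"])
    qed
    moreover have "(0 :: 'k polynomial) \<notin> Units (poly_ring V\<lparr>carrier := range const\<rparr>)"
      by (simp add: Units_def poly_ring_def)
    ultimately show "Units (poly_ring V\<lparr>carrier := range const\<rparr>) = range const - {\<zero>\<^bsub>poly_ring V :: 'k polynomial ring\<^esub>}"
      by (auto simp: poly_ring_def Units_def const_eq_0_iff)
  qed
qed

locale monomial_ideal =
  fixes V :: "nat set" and A :: "monomial set" and R :: "'k::field polynomial ring" (structure)
    and T :: "'k polynomial set"
  defines "R \<equiv> poly_ring V" and "T \<equiv> supported A"
  assumes A_subset: "A \<subseteq> monomials_in V"
    and A_add: "\<And>m h. m \<in> A \<Longrightarrow> h \<in> monomials_in V \<Longrightarrow> m + h \<in> A"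
    and A_proper: "0 \<notin> A"
begin

sublocale R: cring R
  unfolding R_def by (rule poly_ring_cring)

sublocale T: ideal T R
  unfolding R_def T_def using A_subset A_add by (rule supported_ideal)

abbreviation "Q \<equiv> R Quot T"

sublocale Q: ring Q
  by (rule T.quotient_is_ring)

lemma carrier_R: "carrier R = supported (monomials_in V)"
  by (simp add: R_def carrier_poly_ring)

lemma coset_image: "T +> p = (\<lambda>h. h + p) ` T"
  by (auto simp: a_r_coset_def' R_def poly_ring_def)

lemma coset_eq_iff: "T +> p = T +> q \<longleftrightarrow> p - q \<in> T"
proof
  assume "T +> p = T +> q"
  moreover have "0 \<in> T" unfolding T_def by (rule supported_0)
  then have "p \<in> T +> p" by (force simp: coset_image)
  ultimately show "p - q \<in> T" by (auto simp: coset_image)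
next
  assume d: "p - q \<in> T"
  show "T +> p = T +> q"
  proof (auto simp: coset_image)
    fix h assume "h \<in> T"
    then have "h + (p - q) \<in> T" using d by (simp add: T_def supported_add)
    then show "h + p \<in> (\<lambda>h. h + q) ` T" by (auto simp: image_iff intro!: bexI[of _ "h + (p - q)"])
  next
    fix h assume "h \<in> T"
    then have "h - (p - q) \<in> T" using d by (simp add: T_def supported_diff)
    then show "h + q \<in> (\<lambda>h. h + p) ` T" by (auto simp: image_iff intro!: bexI[of _ "h - (p - q)"])
  qed
qed

lemma coset_add:
  assumes "p \<in> carrier R" "q \<in> carrier R" shows "(T +> p) \<oplus>\<^bsub>Q\<^esub> (T +> q) = T +> (p + q)"
  using T.a_rcos_sum[OF assms] by (simp add: FactRing_def R_def poly_ring_def)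

lemma coset_mult:
  assumes "p \<in> carrier R" "q \<in> carrier R" shows "(T +> p) \<otimes>\<^bsub>Q\<^esub> (T +> q) = T +> (p * q)"
  using T.rcoset_mult_add[OF assms] by (simp add: FactRing_def R_def poly_ring_def)

lemma coset_0: "T +> 0 = T"
  by (auto simp: coset_image)

lemma coset_in_carrier: "p \<in> carrier R \<Longrightarrow> T +> p \<in> carrier Q"
  by (auto simp: FactRing_def A_RCOSETS_def')

definition scalars :: "'k polynomial set set" where
  "scalars = (\<lambda>c. T +> const c) ` UNIV"

lemma const_in_carrier: "const c \<in> carrier R"
  unfolding carrier_R by (rule const_in_supported) simp

lemma subfield_scalars: "subfield scalars Q"
proof -
  interpret h: ring_hom_ring R Q "(+>) T" by (rule T.rcos_ring_hom_ring)
  have "(1 :: 'k polynomial) \<notin> T"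
    unfolding T_def supported_def using A_proper by simp
  then have ne: "T +> 1 \<noteq> T"
    using coset_eq_iff[of 1 0] unfolding coset_0 diff_0_right by blast
  have one: "\<one>\<^bsub>Q\<^esub> = T +> 1"
    unfolding FactRing_def by (simp add: R_def poly_ring_def)
  have zero: "\<zero>\<^bsub>Q\<^esub> = T"
    unfolding FactRing_def by simp
  have "subfield (range const) R"
    unfolding R_def by (rule subfield_const)
  then have "subfield ((+>) T ` range const) Q"
    by (rule h.img_is_subfield(2)) (unfold one zero, rule ne)
  then show ?thesis
    unfolding scalars_def image_image .
qed

lemma dimension_cosets:
  assumes "finite S" "S \<subseteq> monomials_in V - A"
  shows "Q.dimension (card S) scalars ((+>) T ` supported S)"
  using assms
proof (induction S)
  case empty
  have "supported {} = {0 :: 'k polynomial}" by (auto simp: supported_def)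
  then have "(+>) T ` supported {} = {\<zero>\<^bsub>Q\<^esub>}" by (simp add: coset_0 FactRing_def)
  then show ?case using Q.zero_dim by simp
next
  case (insert m S)
  let ?E = "(+>) T ` supported S" and ?x = "Poly_Mapping.single m (1::'k)"
  have S: "supported S \<subseteq> carrier R"
    unfolding carrier_R by (rule supported_mono) (use insert.prems in auto)
  have x: "Poly_Mapping.single m c \<in> carrier R" for c
    unfolding carrier_R by (rule supported_single) (use insert.prems in auto)
  have "T +> ?x \<notin> ?E"
  proof
    assume "T +> ?x \<in> ?E"
    then obtain p where p: "p \<in> supported S" "T +> ?x = T +> p" by auto
    then have "?x - p \<in> T" by (simp only: coset_eq_iff)
    then have "?x - p \<in> supported A" by (simp only: T_def)
    moreover have "Poly_Mapping.lookup p m = 0"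
      using p(1) insert.hyps by (auto simp: supported_def in_keys_iff)
    then have "m \<in> Poly_Mapping.keys (?x - p)"
      by (simp add: in_keys_iff lookup_minus)
    ultimately show False using insert.prems by (auto simp: supported_def)
  qed
  with insert have dim: "Q.dimension (Suc (card S)) scalars (Q.line_extension scalars (T +> ?x) ?E)"
    by (intro Q.Suc_dim coset_in_carrier x) auto
  have "Q.line_extension scalars (T +> ?x) ?E =
      {(T +> const c) \<otimes>\<^bsub>Q\<^esub> (T +> ?x) \<oplus>\<^bsub>Q\<^esub> (T +> p) | c p. p \<in> supported S}"
    by (auto simp: Q.line_extension_def set_add_def' r_coset_def scalars_def)
  also have "\<dots> = {T +> (Poly_Mapping.single m c + p) | c p. p \<in> supported S}"
  proof -
    have "(T +> const c) \<otimes>\<^bsub>Q\<^esub> (T +> ?x) \<oplus>\<^bsub>Q\<^esub> (T +> p) = T +> (Poly_Mapping.single m c + p)"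
      if "p \<in> supported S" for c p
      using that S x
      by (simp add: coset_mult[OF const_in_carrier x] const_mult_single coset_add subset_iff)
    then show ?thesis by (intro Collect_cong ex_cong1) auto
  qed
  also have "\<dots> = (+>) T ` supported (insert m S)"
  proof -
    have "supported (insert m S) = {Poly_Mapping.single m c + p | c p :: 'k polynomial. p \<in> supported S}"
    proof (intro equalityI subsetI)
      fix p :: "'k polynomial" assume p: "p \<in> supported (insert m S)"
      let ?c = "Poly_Mapping.lookup p m"
      have "p - Poly_Mapping.single m ?c \<in> supported S"
        using p by (auto simp: supported_def in_keys_iff lookup_minus lookup_single when_def subset_iff split: if_splits)
      moreover have "p = Poly_Mapping.single m ?c + (p - Poly_Mapping.single m ?c)" by simp
      ultimately show "p \<in> {Poly_Mapping.single m c + p | c p. p \<in> supported S}" by blast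
    next
      fix q :: "'k polynomial" assume "q \<in> {Poly_Mapping.single m c + p | c p. p \<in> supported S}"
      then obtain c p where q: "q = Poly_Mapping.single m c + p" and p: "p \<in> supported S" by blast
      have "p \<in> supported (insert m S)" using p supported_mono[of S "insert m S"] by blast
      then show "q \<in> supported (insert m S)"
        unfolding q by (intro supported_add supported_single) auto
    qed
    moreover have "h ` {f c p | c p. P p} = {h (f c p) | c p. P p}"
      for h :: "'k polynomial \<Rightarrow> 'k polynomial set" and f :: "'k \<Rightarrow> 'k polynomial \<Rightarrow> 'k polynomial" and P
      by blast
    ultimately show ?thesis by (simp only:)
  qed
  finally show ?case
    using dim by (simp only: card_insert_disjoint[OF insert.hyps])
qed

lemma dim_cosets:
  assumes "finite S" "S \<subseteq> monomials_in V - A"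
  shows "Q.dim scalars ((+>) T ` supported S) = card S"
  unfolding Q.dim_def over_def
proof (rule the_equality)
  show "Q.dimension (card S) scalars ((+>) T ` supported S)" by (rule dimension_cosets[OF assms])
  show "n = card S" if "Q.dimension n scalars ((+>) T ` supported S)" for n
    by (rule Q.dimension_is_inj[OF subfield_scalars that dimension_cosets[OF assms]])
qed

lemma cosets_standard:
  assumes "D \<subseteq> monomials_in V"
  shows "(+>) T ` supported D = (+>) T ` supported (D - A)"
proof
  show "(+>) T ` supported (D - A) \<subseteq> (+>) T ` supported D"
    by (intro image_mono supported_mono) auto
  show "(+>) T ` supported D \<subseteq> (+>) T ` supported (D - A)"
  proof (rule image_subsetI)
    fix p :: "'k polynomial" assume p: "p \<in> supported D"
    obtain p1 p2 where s: "p = p1 + p2"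
      "Poly_Mapping.keys p1 = Poly_Mapping.keys p \<inter> A" "Poly_Mapping.keys p2 = Poly_Mapping.keys p - A"
      by (rule polynomial_split)
    then have "p - p2 \<in> T" "p2 \<in> supported (D - A)"
      using p by (auto simp: T_def supported_def)
    then show "T +> p \<in> (+>) T ` supported (D - A)" by (simp add: coset_eq_iff[symmetric])
  qed
qed

end

definition exponent_word :: "nat \<Rightarrow> monomial \<Rightarrow> nat list" where
  "exponent_word n m = map (Poly_Mapping.lookup m) [1..<Suc n]"

lemma length_exponent_word: "length (exponent_word n m) = n"
  by (simp add: exponent_word_def)

lemma nth_exponent_word: "i < n \<Longrightarrow> exponent_word n m ! i = Poly_Mapping.lookup m (Suc i)"
  by (simp add: exponent_word_def del: upt_Suc)

lemma sum_list_exponent_word: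
  assumes "m \<in> monomials_in {1..n}"
  shows "sum_list (exponent_word n m) = mono_degree m"
proof -
  have "sum_list (exponent_word n m) = (\<Sum>i\<in>{1..<Suc n}. Poly_Mapping.lookup m i)"
    unfolding exponent_word_def by (simp only: sum_list_distinct_conv_sum_set distinct_upt set_upt)
  also have "\<dots> = mono_degree m"
    unfolding mono_degree_def
    by (rule sum.mono_neutral_right) (use assms in \<open>auto simp: in_keys_iff\<close>)
  finally show ?thesis .
qed

lemma bij_betw_exponent_word:
  "bij_betw (exponent_word n) (monomials_in {1..n}) {w. length w = n}"
proof (rule bij_betw_imageI)
  show "inj_on (exponent_word n) (monomials_in {1..n})"
  proof (rule inj_onI, rule poly_mapping_eqI)
    fix m m' k
    assume m: "m \<in> monomials_in {1..n}" "m' \<in> monomials_in {1..n}"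
      and eq: "exponent_word n m = exponent_word n m'"
    show "Poly_Mapping.lookup m k = Poly_Mapping.lookup m' k"
    proof (cases "k \<in> {1..n}")
      case True
      then have "k - 1 < n" "Suc (k - 1) = k" by auto
      then show ?thesis
        using nth_exponent_word[of "k - 1" n m] nth_exponent_word[of "k - 1" n m'] eq by metis
    next
      case False
      then have "k \<notin> Poly_Mapping.keys m" "k \<notin> Poly_Mapping.keys m'" using m by auto
      then show ?thesis by (simp add: in_keys_iff)
    qed
  qed
  show "exponent_word n ` monomials_in {1..n} = {w. length w = n}"
  proof (intro equalityI subsetI)
    fix w :: "nat list" assume "w \<in> {w. length w = n}"
    then have n: "length w = n" by simp
    let ?m = "Poly_Mapping.nth (0 # w)"
    have lookup: "Poly_Mapping.lookup ?m k = (if k \<in> {1..n} then w ! (k - 1) else 0)" for k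
      by (cases k) (auto simp: nth_default_def n)
    then have "?m \<in> monomials_in {1..n}"
      by (auto simp: in_keys_iff simp del: keys_nth split: if_splits)
    moreover have "exponent_word n ?m = w"
    proof (rule nth_equalityI)
      show "length (exponent_word n ?m) = length w" by (simp only: length_exponent_word n)
      fix i assume "i < length (exponent_word n ?m)"
      then have i: "i < n" by (simp only: length_exponent_word)
      then have "Suc i \<in> {1..n}" "Suc i - 1 = i" by auto
      then show "exponent_word n ?m ! i = w ! i"
        by (simp only: nth_exponent_word[OF i] lookup if_True)
    qed
    ultimately show "w \<in> exponent_word n ` monomials_in {1..n}" by (rule image_eqI[OF sym, rotated])
  qed (auto simp: length_exponent_word)
qed

lemma bij_betw_exponent_word_degree:
  assumes "\<And>m. m \<in> monomials_in {1..n} \<Longrightarrow> P m \<longleftrightarrow> exponent_word n m \<in> L"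
  shows "bij_betw (exponent_word n) {m \<in> monomials_in {1..n}. mono_degree m = j \<and> P m}
    {w \<in> L. length w = n \<and> sum_list w = j}"
proof (rule bij_betw_subset[OF bij_betw_exponent_word])
  have img: "exponent_word n ` monomials_in {1..n} = {w. length w = n}"
    using bij_betw_exponent_word by (rule bij_betw_imp_surj_on)
  show "exponent_word n ` {m \<in> monomials_in {1..n}. mono_degree m = j \<and> P m} =
      {w \<in> L. length w = n \<and> sum_list w = j}"
  proof (intro equalityI subsetI)
    fix w assume w: "w \<in> {w \<in> L. length w = n \<and> sum_list w = j}"
    then have "w \<in> exponent_word n ` monomials_in {1..n}" unfolding img by simp
    then obtain m where "m \<in> monomials_in {1..n}" "w = exponent_word n m" by blast
    with w assms[of m] sum_list_exponent_word[of m n]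
    show "w \<in> exponent_word n ` {m \<in> monomials_in {1..n}. mono_degree m = j \<and> P m}" by auto
  next
    fix w assume "w \<in> exponent_word n ` {m \<in> monomials_in {1..n}. mono_degree m = j \<and> P m}"
    then show "w \<in> {w \<in> L. length w = n \<and> sum_list w = j}"
      using assms by (auto simp: sum_list_exponent_word length_exponent_word)
  qed
qed auto

lemma finite_monomials_of_degree: "finite {m \<in> monomials_in {1..n}. mono_degree m = j}"
proof -
  have "bij_betw (exponent_word n) {m \<in> monomials_in {1..n}. mono_degree m = j \<and> True}
    {w \<in> UNIV. length w = n \<and> sum_list w = j}"
    by (rule bij_betw_exponent_word_degree) simp
  from bij_betw_finite[OF this] finite_words[of UNIV n j] show ?thesis by simp
qed

lemma hilbert_fun_monomial_ideal:
  assumes up: "\<And>m h. m \<in> M \<Longrightarrow> m + h \<in> M" and "0 \<notin> M"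
  shows "hilbert_fun (supported (M \<inter> monomials_in {1..}) :: 'k::field polynomial set) n j
    = card {m \<in> monomials_in {1..n}. mono_degree m = j \<and> m \<notin> M}"
proof -
  let ?I = "supported (M \<inter> monomials_in {1..}) :: 'k polynomial set"
  let ?D = "{m \<in> monomials_in {1..n}. mono_degree m = j}"
  have tr: "trunc ?I n = supported (M \<inter> monomials_in {1..n})"
  proof -
    have "M \<inter> monomials_in {1..} \<inter> monomials_in {1..n} = M \<inter> monomials_in {1..n}" by auto
    then show ?thesis unfolding trunc_def carrier_poly_ring supported_Int by (rule arg_cong)
  qed
  interpret monomial_ideal "{1..n}" "M \<inter> monomials_in {1..n}" "poly_ring {1..n} :: 'k polynomial ring" "trunc ?I n"
  proof unfold_locales
    fix m h assume "m \<in> M \<inter> monomials_in {1..n}" "h \<in> monomials_in {1..n}"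
    then show "m + h \<in> M \<inter> monomials_in {1..n}"
      using up Poly_Mapping.keys_add[of m h] by auto
  qed (use assms tr in auto)
  have "quot_component ?I n j = (+>\<^bsub>KXn n\<^esub>) (trunc ?I n) ` supported ?D"
    unfolding quot_component_def carrier_poly_ring by (rule arg_cong) (auto simp: supported_def)
  also have "\<dots> = (+>\<^bsub>KXn n\<^esub>) (trunc ?I n) ` supported (?D - M \<inter> monomials_in {1..n})"
    by (rule cosets_standard) auto
  also have "?D - M \<inter> monomials_in {1..n} = {m \<in> monomials_in {1..n}. mono_degree m = j \<and> m \<notin> M}"
    by auto
  finally have "hilbert_fun ?I n j = Q.dim scalars ((+>\<^bsub>KXn n\<^esub>) (trunc ?I n) ` supported {m \<in> monomials_in {1..n}. mono_degree m = j \<and> m \<notin> M})"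
    by (simp only: hilbert_fun_def quot_ring_def quot_scalars_def scalars_def)
  also have "\<dots> = card {m \<in> monomials_in {1..n}. mono_degree m = j \<and> m \<notin> M}"
  proof (rule dim_cosets)
    show "finite {m \<in> monomials_in {1..n}. mono_degree m = j \<and> m \<notin> M}"
      by (rule finite_subset[OF _ finite_monomials_of_degree[of n j]]) auto
  qed auto
  finally show ?thesis .
qed

section \<open>Orbit ideals and Higman embedding\<close>

lemma X_power: "X i ^ k = Poly_Mapping.single (Poly_Mapping.single i k) (1 :: 'k::field)"
  by (induction k) (simp_all add: X_def mult_single single_add[symmetric])

lemma prod_X_power:
  "(\<Prod>i\<in>A. X (f i) ^ e i) = Poly_Mapping.single (\<Sum>i\<in>A. Poly_Mapping.single (f i) (e i)) (1 :: 'k::field)"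
  by (induction A rule: infinite_finite_induct) (simp_all add: X_power mult_single)

definition shift :: "(nat \<Rightarrow> nat) \<Rightarrow> monomial \<Rightarrow> monomial" where
  "shift \<pi> m = (\<Sum>i\<in>Poly_Mapping.keys m. Poly_Mapping.single (\<pi> i) (Poly_Mapping.lookup m i))"

lemma inc_act_single:
  "inc_act \<pi> (Poly_Mapping.single m 1) = Poly_Mapping.single (shift \<pi> m) (1 :: 'k::field)"
  by (simp add: inc_act_def const_1 prod_X_power shift_def)

lemma lookup_sum_single:
  assumes "finite A" "inj_on f A"
  shows "i \<in> A \<Longrightarrow> Poly_Mapping.lookup (\<Sum>i\<in>A. Poly_Mapping.single (f i) (e i)) (f i) = e i"
    and "k \<notin> f ` A \<Longrightarrow> Poly_Mapping.lookup (\<Sum>i\<in>A. Poly_Mapping.single (f i) (e i)) k = 0"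
proof -
  assume i: "i \<in> A"
  have "Poly_Mapping.lookup (\<Sum>i\<in>A. Poly_Mapping.single (f i) (e i)) (f i)
      = (\<Sum>i'\<in>A. if i' = i then e i' else 0)"
    unfolding lookup_sum
    by (rule sum.cong) (use assms(2) i in \<open>auto simp: lookup_single when_def dest: inj_onD\<close>)
  then show "Poly_Mapping.lookup (\<Sum>i\<in>A. Poly_Mapping.single (f i) (e i)) (f i) = e i"
    using assms(1) i by simp
next
  assume "k \<notin> f ` A"
  then show "Poly_Mapping.lookup (\<Sum>i\<in>A. Poly_Mapping.single (f i) (e i)) k = 0"
    unfolding lookup_sum by (intro sum.neutral) (auto simp: lookup_single when_def)
qed

lemma multiple_of_shift_iff:
  assumes "inj_on \<pi> (Poly_Mapping.keys m)"
  shows "(\<exists>h. m' = shift \<pi> m + h) \<longleftrightarrow>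
    (\<forall>i\<in>Poly_Mapping.keys m. Poly_Mapping.lookup m i \<le> Poly_Mapping.lookup m' (\<pi> i))"
proof
  note lookup_shift = lookup_sum_single[OF finite_keys assms, of _ "Poly_Mapping.lookup m", folded shift_def]
  {
    assume "\<exists>h. m' = shift \<pi> m + h"
    then obtain h where "m' = shift \<pi> m + h" ..
    then show "\<forall>i\<in>Poly_Mapping.keys m. Poly_Mapping.lookup m i \<le> Poly_Mapping.lookup m' (\<pi> i)"
      by (simp add: lookup_add lookup_shift)
  next
    assume le: "\<forall>i\<in>Poly_Mapping.keys m. Poly_Mapping.lookup m i \<le> Poly_Mapping.lookup m' (\<pi> i)"
    have "Poly_Mapping.lookup (shift \<pi> m) k \<le> Poly_Mapping.lookup m' k" for k
      by (cases "k \<in> \<pi> ` Poly_Mapping.keys m") (use le in \<open>auto simp: lookup_shift\<close>)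
    then have "m' = shift \<pi> m + (m' - shift \<pi> m)"
      by (intro poly_mapping_eqI) (simp add: lookup_add lookup_minus)
    then show "\<exists>h. m' = shift \<pi> m + h" ..
  }
qed

lemma Inc_less:
  assumes "\<pi> \<in> Inc" "1 \<le> i" "i < j" shows "\<pi> i < \<pi> j"
proof -
  have "\<pi> (Suc n) < \<pi> (Suc (Suc n))" for n using assms(1) by (simp add: Inc_def)
  then have "\<pi> (Suc (i - 1)) < \<pi> (Suc (j - 1))"
    by (rule lift_Suc_mono_less) (use assms in simp)
  then show ?thesis using assms by simp
qed

lemma Inc_pos: "\<pi> \<in> Inc \<Longrightarrow> 1 \<le> i \<Longrightarrow> 1 \<le> \<pi> i"
  by (auto simp: Inc_def)

lemma list_emb_iff_strict_mono:
  "list_emb P xs ys \<longleftrightarrow>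
    (\<exists>f. strict_mono_on {..<length xs} f \<and> (\<forall>i<length xs. f i < length ys \<and> P (xs ! i) (ys ! f i)))"
    (is "_ \<longleftrightarrow> (\<exists>f. ?E f xs ys)")
proof
  assume "list_emb P xs ys"
  then show "\<exists>f. ?E f xs ys"
  proof induction
    case (list_emb_Nil ys)
    show ?case by (auto simp: strict_mono_on_def)
  next
    case (list_emb_Cons xs ys y)
    then obtain f where "?E f xs ys" by blast
    then have "?E (\<lambda>i. Suc (f i)) xs (y # ys)" by (simp add: strict_mono_on_def)
    then show ?case by (rule exI[of _ "\<lambda>i. Suc (f i)"])
  next
    case (list_emb_Cons2 x y xs ys)
    then obtain f where "?E f xs ys" by blast
    then have "?E (case_nat 0 (\<lambda>i. Suc (f i))) (x # xs) (y # ys)"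
      using list_emb_Cons2.hyps by (auto simp: strict_mono_on_def split: nat.splits)
    then show ?case by (rule exI[of _ "case_nat 0 (\<lambda>i. Suc (f i))"])
  qed
next
  assume "\<exists>f. ?E f xs ys"
  then show "list_emb P xs ys"
  proof (induction xs arbitrary: ys)
    case Nil
    show ?case by simp
  next
    case (Cons x xs)
    then obtain f where mono: "strict_mono_on {..<length (x # xs)} f"
      and f: "\<And>i. i < length (x # xs) \<Longrightarrow> f i < length ys \<and> P ((x # xs) ! i) (ys ! f i)" by blast
    define k where "k = f 0"
    have k: "k < length ys" "P x (ys ! k)" using f[of 0] by (simp_all add: k_def)
    have above: "k < f (Suc i)" if "i < length xs" for i
      using that by (auto simp: k_def intro!: strict_mono_onD[OF mono])
    have "?E (\<lambda>i. f (Suc i) - Suc k) xs (drop (Suc k) ys)"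
    proof (intro conjI strict_mono_onI allI impI)
      fix i i' assume "i \<in> {..<length xs}" "i' \<in> {..<length xs}" "i < i'"
      moreover from this have "f (Suc i) < f (Suc i')" by (intro strict_mono_onD[OF mono]) auto
      ultimately show "f (Suc i) - Suc k < f (Suc i') - Suc k" using above[of i] by auto
    next
      fix i assume i: "i < length xs"
      with above[of i] f[of "Suc i"] show "f (Suc i) - Suc k < length (drop (Suc k) ys)" by auto
      show "P (xs ! i) (drop (Suc k) ys ! (f (Suc i) - Suc k))"
        using above[OF i] f[of "Suc i"] i k(1) by (simp add: Suc_le_eq)
    qed
    then have "list_emb P xs (drop (Suc k) ys)" by (intro Cons.IH) blast
    then have "list_emb P (x # xs) (take k ys @ ys ! k # drop (Suc k) ys)"
      using k(2) by blast
    then show ?case by (simp add: id_take_nth_drop[OF k(1), symmetric])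
  qed
qed

lemma multiple_of_orbit_iff:
  assumes m0: "m0 \<in> monomials_in {1..N}" "N \<in> Poly_Mapping.keys m0"
    and m: "m \<in> monomials_in {1..n}"
  shows "m \<in> monomial_multiples {shift \<pi> m0 | \<pi>. \<pi> \<in> Inc} \<longleftrightarrow>
    exponent_word n m \<in> containing (exponent_word N m0)"
proof -
  have N: "1 \<le> N" using m0 by auto
  have key: "k \<in> {1..N}" if "k \<in> Poly_Mapping.keys m0" for k using that m0(1) by auto
  have inj: "inj_on \<pi> (Poly_Mapping.keys m0)" if "\<pi> \<in> Inc" for \<pi>
  proof (rule linorder_inj_onI)
    fix i j assume "i < j" "i \<in> Poly_Mapping.keys m0"
    then show "\<pi> i \<noteq> \<pi> j" using key[of i] Inc_less[OF that, of i j] by auto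
  qed linarith
  have "m \<in> monomial_multiples {shift \<pi> m0 | \<pi>. \<pi> \<in> Inc} \<longleftrightarrow>
      (\<exists>\<pi>\<in>Inc. \<exists>h. m = shift \<pi> m0 + h)"
    by (auto simp: monomial_multiples_def)
  also have "\<dots> \<longleftrightarrow>
      (\<exists>\<pi>\<in>Inc. \<forall>i\<in>Poly_Mapping.keys m0. Poly_Mapping.lookup m0 i \<le> Poly_Mapping.lookup m (\<pi> i))"
    by (rule bex_cong[OF refl]) (rule multiple_of_shift_iff[OF inj])
  also have "\<dots> \<longleftrightarrow> (\<exists>f. strict_mono_on {..<N} f \<and>
      (\<forall>i<N. f i < n \<and> Poly_Mapping.lookup m0 (Suc i) \<le> Poly_Mapping.lookup m (Suc (f i))))"
    (is "?L \<longleftrightarrow> ?R")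
  proof
    assume ?L
    then obtain \<pi> where \<pi>: "\<pi> \<in> Inc"
      and le: "\<And>i. i \<in> Poly_Mapping.keys m0 \<Longrightarrow> Poly_Mapping.lookup m0 i \<le> Poly_Mapping.lookup m (\<pi> i)"
      by blast
    have "Poly_Mapping.lookup m (\<pi> N) \<noteq> 0"
      using le[OF m0(2)] m0(2) by (simp add: in_keys_iff)
    then have "\<pi> N \<in> Poly_Mapping.keys m" by (simp add: in_keys_iff)
    then have last: "\<pi> N \<le> n" using m by auto
    have suc: "Suc (\<pi> (Suc i) - 1) = \<pi> (Suc i)" for i using Inc_pos[OF \<pi>, of "Suc i"] by simp
    have "strict_mono_on {..<N} (\<lambda>i. \<pi> (Suc i) - 1)"
    proof (rule strict_mono_onI)
      fix i j :: nat assume "i < j"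
      then have "\<pi> (Suc i) < \<pi> (Suc j)" by (intro Inc_less[OF \<pi>]) auto
      then show "\<pi> (Suc i) - 1 < \<pi> (Suc j) - 1" using suc[of i] suc[of j] by linarith
    qed
    moreover have "\<pi> (Suc i) - 1 < n" if "i < N" for i
    proof -
      have "\<pi> (Suc i) \<le> \<pi> N"
        using that Inc_less[OF \<pi>, of "Suc i" N] by (cases "Suc i = N") auto
      then show ?thesis using last suc[of i] by linarith
    qed
    moreover have "Poly_Mapping.lookup m0 (Suc i) \<le> Poly_Mapping.lookup m (Suc (\<pi> (Suc i) - 1))" for i
      unfolding suc using le[of "Suc i"] by (cases "Suc i \<in> Poly_Mapping.keys m0") (auto simp: in_keys_iff)
    ultimately show ?R by blast
  next
    assume ?R
    then obtain f where mono: "strict_mono_on {..<N} f"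
      and f: "\<And>i. i < N \<Longrightarrow> f i < n \<and> Poly_Mapping.lookup m0 (Suc i) \<le> Poly_Mapping.lookup m (Suc (f i))"
      by blast
    define \<pi> where "\<pi> i = (if i \<le> N then Suc (f (i - 1)) else Suc (f (N - 1)) + (i - N))" for i
    have "\<pi> i < \<pi> (i + 1)" if "1 \<le> i" for i
    proof (cases "i < N")
      case True
      then have "f (i - 1) < f i" using that by (intro strict_mono_onD[OF mono]) auto
      then show ?thesis using True by (simp add: \<pi>_def)
    next
      case False
      then show ?thesis by (cases "i = N") (auto simp: \<pi>_def)
    qed
    then have "\<pi> \<in> Inc" by (auto simp: Inc_def \<pi>_def)
    moreover have "Poly_Mapping.lookup m0 i \<le> Poly_Mapping.lookup m (\<pi> i)" if "i \<in> Poly_Mapping.keys m0" for i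
    proof -
      have "1 \<le> i" "i \<le> N" using key[OF that] by auto
      then show ?thesis using f[of "i - 1"] by (simp add: \<pi>_def)
    qed
    ultimately show ?L by blast
  qed
  also have "\<dots> \<longleftrightarrow> exponent_word n m \<in> containing (exponent_word N m0)"
    unfolding containing_def mem_Collect_eq list_emb_iff_strict_mono length_exponent_word
    by (intro ex_cong1 conj_cong refl all_cong) (simp add: nth_exponent_word cong: conj_cong)
  finally show ?thesis .
qed

lemma equivariant_hilbert_series_Inc_ideal:
  assumes m0: "m0 \<in> monomials_in {1..N}" "N \<in> Poly_Mapping.keys m0"
  shows "equivariant_hilbert_series (Inc_ideal (Poly_Mapping.single m0 1) :: 'k::field polynomial set)
    = word_series (- containing (exponent_word N m0))"
proof -
  let ?G = "{shift \<pi> m0 | \<pi>. \<pi> \<in> Inc}"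
  let ?M = "monomial_multiples ?G"
  have G: "?G \<subseteq> monomials_in {1..}"
  proof
    fix g assume "g \<in> ?G"
    then obtain \<pi> where \<pi>: "\<pi> \<in> Inc" and g: "g = shift \<pi> m0" by blast
    have "Poly_Mapping.keys g \<subseteq> \<pi> ` Poly_Mapping.keys m0"
      unfolding g shift_def by (rule order_trans[OF keys_sum]) auto
    moreover have "\<pi> i \<in> {1..}" if "i \<in> Poly_Mapping.keys m0" for i
      using m0(1) that Inc_pos[OF \<pi>, of i] by auto
    ultimately show "g \<in> monomials_in {1..}" by blast
  qed
  have "{inc_act \<pi> (Poly_Mapping.single m0 1) | \<pi>. \<pi> \<in> Inc} =
      {Poly_Mapping.single g (1::'k) | g. g \<in> ?G}"
    unfolding inc_act_single by blast
  then have ideal: "Inc_ideal (Poly_Mapping.single m0 1) = (supported (?M \<inter> monomials_in {1..}) :: 'k polynomial set)"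
    unfolding Inc_ideal_def by (simp only: genideal_monomials[OF G])
  have M0: "0 \<notin> ?M"
  proof -
    have "exponent_word N m0 \<noteq> []" using m0 length_exponent_word[of N m0] by auto
    then have "exponent_word 0 0 \<notin> containing (exponent_word N m0)"
      using list_emb_Nil2 by (auto simp: containing_def exponent_word_def[of 0])
    then show ?thesis using multiple_of_orbit_iff[OF m0, of 0 0] by simp
  qed
  have up: "m + h \<in> ?M" if "m \<in> ?M" for m h
    using that by (auto simp: monomial_multiples_def) (metis add.assoc)
  show ?thesis
  proof (intro fps_ext)
    fix n j :: nat
    have "bij_betw (exponent_word n) {m \<in> monomials_in {1..n}. mono_degree m = j \<and> m \<notin> ?M}
        {w \<in> - containing (exponent_word N m0). length w = n \<and> sum_list w = j}"
      by (rule bij_betw_exponent_word_degree) (simp only: multiple_of_orbit_iff[OF m0] Compl_iff)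
    note same = bij_betw_same_card[OF this]
    have "hilbert_fun (supported (?M \<inter> monomials_in {1..}) :: 'k polynomial set) n j =
        card {w \<in> - containing (exponent_word N m0). length w = n \<and> sum_list w = j}"
      by (rule trans[OF hilbert_fun_monomial_ideal same]) (rule up M0, assumption?)+
    then show "equivariant_hilbert_series (Inc_ideal (Poly_Mapping.single m0 1) :: 'k polynomial set) $ n $ j
        = word_series (- containing (exponent_word N m0)) $ n $ j"
      unfolding ideal equivariant_hilbert_series_def word_series_nth by (simp only: fps_nth_Abs_fps)
  qed
qed

theorem theorem1p1:
  fixes r :: nat and \<mu> a :: "nat \<Rightarrow> nat" and I :: "'k::field polynomial set"
  assumes "r \<ge> 1"
    and "\<forall>j\<in>{1..r}. \<mu> j > 0"
    and "strict_mono_on {1..r} \<mu>"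
    and "\<forall>j\<in>{1..r}. a j > 0"
    and "I = Inc_ideal (\<Prod>j\<in>{1..r}. X (\<mu> j) ^ a j)"
  shows "\<exists>g :: int poly poly.
           equivariant_hilbert_series I
             * fps_of_poly2 ((1 - t_var) ^ (\<mu> r - 1) * (\<Prod>j\<in>{1..r}. s_factor (a j)))
             = fps_of_poly2 g
         \<and> \<not> (1 - t_var) dvd g
         \<and> (\<forall>j\<in>{1..r}. \<not> s_factor (a j) dvd g)
         \<and> Factorial_Ring.irreducible (1 - t_var)
         \<and> (\<forall>j\<in>{1..r}. Factorial_Ring.irreducible (s_factor (a j)))"
proof -
  define m0 where "m0 = (\<Sum>j\<in>{1..r}. Poly_Mapping.single (\<mu> j) (a j))"
  define v where "v = exponent_word (\<mu> r) m0"
  have inj: "inj_on \<mu> {1..r}" using assms(3) by (rule strict_mono_on_imp_inj_on)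
  note lookup = lookup_sum_single[OF finite_atLeastAtMost inj, of _ a, folded m0_def]
  have le: "\<mu> j \<le> \<mu> r" if "j \<in> {1..r}" for j
    using strict_mono_onD[OF assms(3) that, of r] that by (cases "j = r") auto
  have keys: "Poly_Mapping.keys m0 = \<mu> ` {1..r}"
  proof (intro equalityI subsetI)
    fix k assume "k \<in> Poly_Mapping.keys m0"
    then show "k \<in> \<mu> ` {1..r}" using lookup(2)[of k] by (auto simp: in_keys_iff)
  next
    fix k assume "k \<in> \<mu> ` {1..r}"
    then show "k \<in> Poly_Mapping.keys m0" using lookup(1) assms(4) by (auto simp: in_keys_iff)
  qed
  have m0: "m0 \<in> monomials_in {1..\<mu> r}" "\<mu> r \<in> Poly_Mapping.keys m0"
    using le assms(1,2) by (auto simp: keys Suc_le_eq)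
  have I: "equivariant_hilbert_series I = word_series (- containing v)"
    unfolding assms(5) prod_X_power m0_def[symmetric] v_def
    by (rule equivariant_hilbert_series_Inc_ideal[OF m0])
  have set_v: "a j \<in> set v" if "j \<in> {1..r}" for j
  proof -
    have "a j = Poly_Mapping.lookup m0 (\<mu> j)" using that by (simp add: lookup)
    moreover have "0 < \<mu> j" "\<mu> j \<le> \<mu> r" using that le assms(2) by blast+
    then have "\<mu> j \<in> {1..<Suc (\<mu> r)}" by simp
    ultimately show ?thesis unfolding v_def exponent_word_def set_map set_upt by (rule image_eqI)
  qed
  have prod_v: "prod_list (map s_factor v) = (\<Prod>j\<in>{1..r}. s_factor (a j))"
  proof -
    have "prod_list (map s_factor v) = (\<Prod>i\<in>{1..<Suc (\<mu> r)}. s_factor (Poly_Mapping.lookup m0 i))"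
      by (simp add: v_def exponent_word_def prod.distinct_set_conv_list o_def del: upt_Suc flip: set_upt)
    also have "\<dots> = (\<Prod>i\<in>\<mu> ` {1..r}. s_factor (Poly_Mapping.lookup m0 i))"
    proof (rule prod.mono_neutral_right)
      show "\<mu> ` {1..r} \<subseteq> {1..<Suc (\<mu> r)}"
      proof (rule image_subsetI)
        fix j assume "j \<in> {1..r}"
        then have "0 < \<mu> j" "\<mu> j \<le> \<mu> r" using le assms(2) by blast+
        then show "\<mu> j \<in> {1..<Suc (\<mu> r)}" by simp
      qed
    qed (auto simp: lookup(2))
    also have "\<dots> = (\<Prod>j\<in>{1..r}. s_factor (a j))"
      by (rule prod.reindex_cong[OF inj refl]) (simp only: lookup(1))
    finally show ?thesis .
  qed
  have "v \<noteq> []" using set_v[of r] assms(1) by auto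
  then obtain g where "word_series (- containing v)
      * fps_of_poly2 ((1 - t_var) ^ (length v - 1) * prod_list (map s_factor v)) = fps_of_poly2 g"
    and ndvd: "\<not> (1 - t_var) dvd g" "\<And>b. b \<in> set v \<Longrightarrow> b > 0 \<Longrightarrow> \<not> s_factor b dvd g"
    by (rule word_series_not_containing) blast
  then have "equivariant_hilbert_series I
      * fps_of_poly2 ((1 - t_var) ^ (\<mu> r - 1) * (\<Prod>j\<in>{1..r}. s_factor (a j))) = fps_of_poly2 g"
    by (simp only: I prod_v) (simp only: v_def length_exponent_word)
  moreover have "\<not> s_factor (a j) dvd g" if "j \<in> {1..r}" for j
    by (rule ndvd(2)[OF set_v[OF that] bspec[OF assms(4) that]])
  moreover have "Factorial_Ring.irreducible (s_factor (a j))" if "j \<in> {1..r}" for j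
    by (rule irreducible_s_factor[OF bspec[OF assms(4) that]])
  ultimately show ?thesis
    using ndvd(1) irreducible_one_minus_t_var by (intro exI[of _ g] conjI ballI)
qed

end
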